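(* Let $T\ge 1$ and let $A_1,\dots,A_T\in[-1,1]^{d_1\times d_2}$ be an arbitrary sequence of matrices. Let $G\in(0,1]$ be a Lipschitz constant with respect to $\|\cdot\|_1$ of all the functions $(x,y)\mapsto x^\top A_t y$ on $\Delta_{d_1}\times\Delta_{d_2}$, $t=1,\dots,T$. Set $\eta=\frac{\sqrt T}{G}$ and $\theta=e^{-\eta G}$ (so that $\frac{|\ln\theta|}{\eta}=G$), and assume $\theta\le\min\{\frac1{d_1},\frac1{d_2}\}$. Let $\{(x_t,y_t)\}_{t=1}^T$ be the iterates of the algorithm OMG-RFTL run with parameters $\eta,\theta$ on $A_1,\dots,A_T$. Then $$\left|\sum_{t=1}^T x_t^\top A_t y_t-\min_{x\in\Delta_{d_1}}\max_{y\in\Delta_{d_2}}\sum_{t=1}^T x^\top A_t y\right|\le 32\,G\sqrt T\,(1+\ln T)+2\sqrt T\max\{\ln d_1,\ln d_2\}+2\max\{d_1,d_2\}\,G\,T e^{-\sqrt T},$$ and the right-hand side is $O\big(\ln(T)\sqrt T+\sqrt T\max\{\ln d_1,\ln d_2\}\big)+o(1)\max\{d_1,d_2\}$ as $T\to\infty$.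
   Context: $\Delta_d=\{v\in\mathbb{R}^d:\ v\ge0,\ \|v\|_1=1\}$ and, for $\theta\in[0,1/d]$, $\Delta_{d,\theta}=\{z\in\mathbb{R}^d:\ \|z\|_1=1,\ z_i\ge\theta,\ i=1,\dots,d\}$. A function $\mathcal L(x,y)$ is $G$-Lipschitz with respect to $\|\cdot\|_1$ if $|\mathcal L(x_1,y_1)-\mathcal L(x_2,y_2)|\le G\|[x_1;y_1]-[x_2;y_2]\|_1$ for all $(x_1,y_1),(x_2,y_2)$ in its domain, where $[x;y]$ denotes concatenation. Algorithm OMG-RFTL with parameters $\eta>0$, $\theta$: let $R_X(x)=\sum_{i=1}^{d_1}x_i\ln x_i+\ln d_1$ and $R_Y(y)=\sum_{i=1}^{d_2}y_i\ln y_i+\ln d_2$. The initial pair $(x_1,y_1)\in\Delta_{d_1,\theta}\times\Delta_{d_2,\theta}$ is arbitrary. In round $t=1,\dots,T$ the pair $(x_t,y_t)$ is played, $A_t$ is observed, one sets $\mathcal L_t(x,y)=x^\top A_t y+\frac1\eta R_X(x)-\frac1\eta R_Y(y)$, and $$x_{t+1}=\arg\min_{x\in\Delta_{d_1,\theta}}\max_{y\in\Delta_{d_2,\theta}}\sum_{\tau=1}^t\mathcal L_\tau(x,y),\qquad y_{t+1}=\arg\max_{y\in\Delta_{d_2,\theta}}\min_{x\in\Delta_{d_1,\theta}}\sum_{\tau=1}^t\mathcal L_\tau(x,y).$$ *)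

theory Defs
  imports "HOL-Analysis.Analysis" "HOL-Library.Landau_Symbols"
begin

definition norm1 :: "real ^ 'd \<Rightarrow> real" where
  "norm1 v = (\<Sum>i\<in>UNIV. \<bar>v $ i\<bar>)"

definition prob_simplex :: "(real ^ 'd) set" where
  "prob_simplex = {v. (\<forall>i. 0 \<le> v $ i) \<and> norm1 v = 1}"

definition trunc_simplex :: "real \<Rightarrow> (real ^ 'd) set" where
  "trunc_simplex \<theta> = {z. norm1 z = 1 \<and> (\<forall>i. \<theta> \<le> z $ i)}"

definition vconcat :: "real ^ 'm \<Rightarrow> real ^ 'n \<Rightarrow> real ^ ('m + 'n)" where
  "vconcat x y = (\<chi> k. case k of Inl i \<Rightarrow> x $ i | Inr j \<Rightarrow> y $ j)"

definition lipschitz_norm1_on ::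
    "real \<Rightarrow> (real ^ 'm) set \<Rightarrow> (real ^ 'n) set \<Rightarrow> (real ^ 'm \<Rightarrow> real ^ 'n \<Rightarrow> real) \<Rightarrow> bool" where
  "lipschitz_norm1_on G X Y L \<longleftrightarrow>
     (\<forall>x1\<in>X. \<forall>y1\<in>Y. \<forall>x2\<in>X. \<forall>y2\<in>Y.
        \<bar>L x1 y1 - L x2 y2\<bar> \<le> G * norm1 (vconcat x1 y1 - vconcat x2 y2))"

definition bilin :: "real ^ 'n ^ 'm \<Rightarrow> real ^ 'm \<Rightarrow> real ^ 'n \<Rightarrow> real" where
  "bilin M x y = x \<bullet> (M *v y)"

text \<open>The library value \<open>ln 0 = 0\<close> realises the usual convention \<open>0 ln 0 = 0\<close>.\<close>
definition entropy_reg :: "real ^ 'd \<Rightarrow> real" where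
  "entropy_reg x = (\<Sum>i\<in>UNIV. x $ i * ln (x $ i)) + ln (real CARD('d))"

definition reg_payoff :: "real \<Rightarrow> real ^ 'n ^ 'm \<Rightarrow> real ^ 'm \<Rightarrow> real ^ 'n \<Rightarrow> real" where
  "reg_payoff \<eta> M x y = bilin M x y + 1 / \<eta> * entropy_reg x - 1 / \<eta> * entropy_reg y"

text \<open>
  The sequences are indexed from 1; values at index 0 and beyond \<open>T\<close> are irrelevant. Inner
  maxima and minima are written as suprema and infima; the payoffs are continuous and
  the simplices compact, so these are attained. The pair is a run of the algorithm if every
  iterate is an optimiser of the prescribed problem.
\<close>
definition omg_rftl_run ::
    "real \<Rightarrow> real \<Rightarrow> nat \<Rightarrow> (nat \<Rightarrow> real ^ 'n ^ 'm) \<Rightarrow>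
     (nat \<Rightarrow> real ^ 'm) \<Rightarrow> (nat \<Rightarrow> real ^ 'n) \<Rightarrow> bool" where
  "omg_rftl_run \<eta> \<theta> T A x y \<longleftrightarrow>
     x 1 \<in> trunc_simplex \<theta> \<and> y 1 \<in> trunc_simplex \<theta> \<and>
     (\<forall>t\<in>{1..<T}.
        is_arg_min (\<lambda>u. SUP v\<in>trunc_simplex \<theta>. \<Sum>\<tau>=1..t. reg_payoff \<eta> (A \<tau>) u v)
          (\<lambda>u. u \<in> trunc_simplex \<theta>) (x (Suc t)) \<and>
        is_arg_max (\<lambda>v. INF u\<in>trunc_simplex \<theta>. \<Sum>\<tau>=1..t. reg_payoff \<eta> (A \<tau>) u v)
          (\<lambda>v. v \<in> trunc_simplex \<theta>) (y (Suc t)))"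

definition regret_bound :: "real \<Rightarrow> nat \<Rightarrow> nat \<Rightarrow> nat \<Rightarrow> real" where
  "regret_bound G T d1 d2 =
     32 * G * sqrt (real T) * (1 + ln (real T))
     + 2 * sqrt (real T) * max (ln (real d1)) (ln (real d2))
     + 2 * real (max d1 d2) * G * real T * exp (- sqrt (real T))"

text \<open>
  The filter for \<open>T \<longrightarrow> \<infinity>\<close>, uniformly in the Lipschitz constant \<open>G\<close> and the
  dimensions \<open>d1\<close>, \<open>d2\<close>: a property holds eventually iff it holds for all
  large \<open>T\<close> and all admissible \<open>(G, d1, d2)\<close>, with one threshold on \<open>T\<close>.
\<close>
definition unif_at_top :: "(nat \<times> real \<times> nat \<times> nat) filter" where
  "unif_at_top = sequentially \<times>\<^sub>F principal {(G, d1, d2). 0 < G \<and> G \<le> 1 \<and> 1 \<le> d1 \<and> 1 \<le> d2}"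

end

theory Submission imports Defs "HOL-Real_Asymp.Real_Asymp" begin

text \<open>Write \<open>S\<^sub>t = \<Sum>\<tau>\<le>t. L\<^sub>\<tau>\<close>; every iterate \<open>(x\<^sub>t\<^sub>+\<^sub>1, y\<^sub>t\<^sub>+\<^sub>1)\<close> is a
  saddle point of \<open>S\<^sub>t\<close>. Testing the saddle inequalities of \<open>S\<^sub>t\<^sub>-\<^sub>1\<close> and
  \<open>S\<^sub>t\<close> against each other's points shows that the saddle value grows in round
  \<open>t\<close> by \<open>L\<^sub>t(x\<^sub>t, y\<^sub>t)\<close>, up to the variation of \<open>L\<^sub>t\<close> between consecutive
  iterates. The entropy makes \<open>S\<^sub>t\<close> strongly convex-concave in the 1-norm with modulus
  \<open>t / \<eta>\<close>, so consecutive iterates are \<open>O(G \<eta> / t)\<close> apart and these errors sum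
  to \<open>O(G\<^sup>2 \<eta> ln T)\<close>. Dropping the regulariser costs \<open>T / \<eta>\<close> times the
  maximal entropy, twice (for the iterates and for the saddle value), and passing from the
  truncated to the full simplices costs \<open>O(d G T \<theta>)\<close>.\<close>

text \<open>With \<open>c\<close> = 1 / \<eta> this is the payoff of one round, with
  \<open>c\<close> = t / \<eta> the sum of the first t rounds; \<open>c\<close> is also the modulus
  of strong convexity-concavity in the 1-norm.\<close>

definition ent_game :: "real \<Rightarrow> real ^ 'n ^ 'm \<Rightarrow> real ^ 'm \<Rightarrow> real ^ 'n \<Rightarrow> real" where
  "ent_game c M u v = bilin M u v + c * entropy_reg u - c * entropy_reg v"

text \<open>The first player minimises. Stating optimality by pointwise inequalities avoids
  exchanging SUP and INF; the value of the game is then \<open>S x y\<close>.\<close>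

definition saddle :: "'a set \<Rightarrow> 'b set \<Rightarrow> ('a \<Rightarrow> 'b \<Rightarrow> real) \<Rightarrow> 'a \<Rightarrow> 'b \<Rightarrow> bool" where
  "saddle X Y S x y \<longleftrightarrow> x \<in> X \<and> y \<in> Y \<and> (\<forall>u\<in>X. S x y \<le> S u y) \<and> (\<forall>v\<in>Y. S x v \<le> S x y)"

section \<open>The 1-norm and the truncated simplices\<close>

lemma norm1_ge_0: "0 \<le> norm1 v"
  by (simp add: norm1_def sum_nonneg)

lemma norm1_minus_commute: "norm1 (u - v) = norm1 (v - u)"
  by (simp add: norm1_def abs_minus_commute)

lemma norm_le_norm1: "norm v \<le> norm1 v"
  unfolding norm1_def by (rule norm_le_l1_cart)

lemma norm1_vconcat_diff:
  "norm1 (vconcat x y - vconcat x' y') = norm1 (x - x') + norm1 (y - y')"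
  unfolding norm1_def UNIV_Plus_UNIV[symmetric]
  by (subst sum.Plus) (simp_all add: vconcat_def)

lemma prob_simplex_eq_trunc: "prob_simplex = trunc_simplex 0"
  by (auto simp: prob_simplex_def trunc_simplex_def)

lemma trunc_simplex_eq:
  assumes "0 \<le> \<theta>"
  shows "trunc_simplex \<theta> = {z. (\<Sum>i\<in>UNIV. z $ i) = 1 \<and> (\<forall>i. \<theta> \<le> z $ i)}"
proof -
  have "norm1 z = (\<Sum>i\<in>UNIV. z $ i)" if "\<forall>i. \<theta> \<le> z $ i" for z :: "real ^ 'a"
    using that assms unfolding norm1_def by (intro sum.cong refl abs_of_nonneg) (meson order_trans)
  then show ?thesis by (auto simp: trunc_simplex_def)
qed

lemma trunc_simplex_subset_prob: "0 \<le> \<theta> \<Longrightarrow> trunc_simplex \<theta> \<subseteq> prob_simplex"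
  by (auto simp: prob_simplex_def trunc_simplex_def intro: order_trans)

lemma trunc_simplex_coord_le_1:
  assumes "z \<in> trunc_simplex \<theta>"
  shows "z $ i \<le> 1"
proof -
  have "\<bar>z $ i\<bar> \<le> norm1 z"
    unfolding norm1_def by (rule member_le_sum) auto
  then show ?thesis using assms by (auto simp: trunc_simplex_def)
qed

lemma convex_trunc_simplex:
  assumes "0 \<le> \<theta>"
  shows "convex (trunc_simplex \<theta>)"
  unfolding trunc_simplex_eq[OF assms]
proof (rule convexI, safe)
  fix x y :: "real ^ 'a" and u v :: real
  assume *: "0 \<le> u" "0 \<le> v" "u + v = 1"
    "sum (($) x) UNIV = 1" "\<forall>i. \<theta> \<le> x $ i" "sum (($) y) UNIV = 1" "\<forall>i. \<theta> \<le> y $ i"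
  show "sum (($) (u *\<^sub>R x + v *\<^sub>R y)) UNIV = 1"
    using * by (simp add: sum.distrib flip: sum_distrib_left)
  fix i
  have "u * \<theta> + v * \<theta> \<le> u * x $ i + v * y $ i"
    using * by (intro add_mono mult_left_mono) auto
  moreover have "u * \<theta> + v * \<theta> = \<theta>"
    using * by (simp flip: distrib_right)
  ultimately show "\<theta> \<le> (u *\<^sub>R x + v *\<^sub>R y) $ i" by simp
qed

lemma compact_trunc_simplex: "compact (trunc_simplex \<theta>)"
proof -
  have "closed (trunc_simplex \<theta> :: (real ^ 'a) set)"
    unfolding trunc_simplex_def norm1_def
    by (intro closed_Collect_conj closed_Collect_all closed_Collect_eq closed_Collect_le continuous_intros)
  moreover have "bounded (trunc_simplex \<theta> :: (real ^ 'a) set)"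
    unfolding bounded_iff trunc_simplex_def by (intro exI[of _ 1]) (auto intro: order_trans[OF norm_le_norm1])
  ultimately show ?thesis by (simp add: compact_eq_bounded_closed)
qed

lemma trunc_simplex_nonempty:
  assumes "0 \<le> \<theta>" "\<theta> \<le> 1 / real CARD('d)"
  shows "trunc_simplex \<theta> \<noteq> ({} :: (real ^ 'd) set)"
proof -
  have "(\<chi> i. 1 / real CARD('d)) \<in> (trunc_simplex \<theta> :: (real ^ 'd) set)"
    using assms by (simp add: trunc_simplex_eq)
  then show ?thesis by blast
qed

text \<open>Mixing \<open>u\<close> with the uniform distribution, with weight d \<theta>, lifts
  every coordinate to at least \<theta>; in the 1-norm this moves \<open>u\<close> by at most d
  \<theta> times the distance 2 of two distributions.\<close>

lemma trunc_simplex_approx: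
  fixes u :: "real ^ 'd"
  assumes "0 \<le> \<theta>" "\<theta> \<le> 1 / real CARD('d)" "u \<in> prob_simplex"
  obtains w where "w \<in> trunc_simplex \<theta>" "norm1 (u - w) \<le> 2 * real CARD('d) * \<theta>"
proof
  let ?d = "real CARD('d)"
  let ?w = "\<chi> i. (1 - ?d * \<theta>) * u $ i + \<theta>"
  have u: "sum (($) u) UNIV = 1" "\<And>i. 0 \<le> u $ i"
    using assms(3) by (auto simp: prob_simplex_eq_trunc trunc_simplex_eq)
  have d: "0 \<le> 1 - ?d * \<theta>"
    using assms(2) by (simp add: field_simps)
  show "?w \<in> trunc_simplex \<theta>"
    using u d assms(1) by (simp add: trunc_simplex_eq sum.distrib flip: sum_distrib_left)
  have "norm1 (u - ?w) = (\<Sum>i\<in>UNIV. \<bar>?d * \<theta> * u $ i - \<theta>\<bar>)"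
    by (simp add: norm1_def algebra_simps)
  also have "\<dots> \<le> (\<Sum>i\<in>UNIV. ?d * \<theta> * u $ i + \<theta>)"
    using u(2) assms(1) by (intro sum_mono) (auto intro!: abs_leI)
  also have "\<dots> = 2 * ?d * \<theta>"
    using u(1) by (simp add: sum.distrib flip: sum_distrib_left)
  finally show "norm1 (u - ?w) \<le> 2 * ?d * \<theta>" .
qed

section \<open>Range, Lipschitz constant and continuity of the entropy\<close>

text \<open>On the simplex \<open>entropy_reg\<close> is the Kullback-Leibler divergence from the
  uniform distribution; Gibbs' inequality follows from ln s \<le> s - 1 at s = 1 / (d z_i).\<close>

lemma entropy_reg_nonneg:
  fixes z :: "real ^ 'd"
  assumes "0 < \<theta>" "z \<in> trunc_simplex \<theta>"
  shows "0 \<le> entropy_reg z"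
proof -
  let ?d = "real CARD('d)"
  have z: "sum (($) z) UNIV = 1" "\<And>i. 0 < z $ i"
    using assms by (auto simp: trunc_simplex_eq intro: less_le_trans)
  have "0 = (\<Sum>i\<in>UNIV. z $ i - 1 / ?d)"
    using z(1) by (simp add: sum_subtractf)
  also have "\<dots> \<le> (\<Sum>i\<in>UNIV. z $ i * ln (z $ i) + z $ i * ln ?d)"
  proof (intro sum_mono)
    fix i
    have "ln (1 / (?d * z $ i)) \<le> 1 / (?d * z $ i) - 1"
      using z(2) by (intro ln_le_minus_one) simp
    then have "1 - 1 / (?d * z $ i) \<le> ln (z $ i) + ln ?d"
      using z(2)[of i] by (simp add: ln_div ln_mult)
    then have "z $ i * (1 - 1 / (?d * z $ i)) \<le> z $ i * (ln (z $ i) + ln ?d)"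
      using z(2)[of i] by (intro mult_left_mono) auto
    then show "z $ i - 1 / ?d \<le> z $ i * ln (z $ i) + z $ i * ln ?d"
      using z(2)[of i] by (simp add: algebra_simps)
  qed
  also have "\<dots> = entropy_reg z"
    using z(1) by (simp add: entropy_reg_def sum.distrib flip: sum_distrib_right)
  finally show ?thesis .
qed

lemma entropy_reg_le:
  fixes z :: "real ^ 'd"
  assumes "0 < \<theta>" "z \<in> trunc_simplex \<theta>"
  shows "entropy_reg z \<le> ln (real CARD('d))"
proof -
  have "z $ i * ln (z $ i) \<le> 0" for i
  proof -
    have "0 < z $ i" "z $ i \<le> 1"
      using assms trunc_simplex_coord_le_1[OF assms(2)] by (auto simp: trunc_simplex_def intro: less_le_trans)
    then show ?thesis by (simp add: mult_nonneg_nonpos)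
  qed
  then show ?thesis
    by (simp add: entropy_reg_def sum_nonpos)
qed

text \<open>Coordinatewise, the derivative ln s + 1 of s ln s lies between ln \<theta> + 1 and 1 on
  [\<theta>, 1]. The condition \<theta> \<le> exp (-1) makes -ln \<theta> at least 1, so it
  dominates both ends.\<close>

lemma entropy_reg_lipschitz:
  fixes u v :: "real ^ 'd"
  assumes "0 < \<theta>" "\<theta> \<le> exp (- 1)" "u \<in> trunc_simplex \<theta>" "v \<in> trunc_simplex \<theta>"
  shows "\<bar>entropy_reg u - entropy_reg v\<bar> \<le> - ln \<theta> * norm1 (u - v)"
proof -
  have L: "1 \<le> - ln \<theta>"
    using assms(1,2) ln_mono[of \<theta> "exp (-1)"] by simp
  have coord: "norm (p * ln p - q * ln q) \<le> - ln \<theta> * norm (p - q)"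
    if "p \<in> {\<theta>..1}" "q \<in> {\<theta>..1}" for p q :: real
  proof (rule field_differentiable_bound[where S = "{\<theta>..1}" and f' = "\<lambda>s. ln s + 1"])
    show "((\<lambda>s. s * ln s) has_field_derivative ln s + 1) (at s within {\<theta>..1})" if "s \<in> {\<theta>..1}" for s
      using that assms(1) by (auto intro!: derivative_eq_intros)
    show "norm (ln s + 1) \<le> - ln \<theta>" if "s \<in> {\<theta>..1}" for s
    proof -
      have "ln \<theta> \<le> ln s" "ln s \<le> 0"
        using that assms(1) by auto
      then show ?thesis using L by simp
    qed
  qed (use that in auto)
  have mem: "z $ i \<in> {\<theta>..1}" if "z \<in> trunc_simplex \<theta>" for z :: "real ^ 'd" and i
    using that trunc_simplex_coord_le_1[OF that] by (simp add: trunc_simplex_def)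
  have "\<bar>entropy_reg u - entropy_reg v\<bar> = \<bar>\<Sum>i\<in>UNIV. u $ i * ln (u $ i) - v $ i * ln (v $ i)\<bar>"
    by (simp add: entropy_reg_def sum_subtractf)
  also have "\<dots> \<le> (\<Sum>i\<in>UNIV. \<bar>u $ i * ln (u $ i) - v $ i * ln (v $ i)\<bar>)"
    by (rule sum_abs)
  also have "\<dots> \<le> (\<Sum>i\<in>UNIV. - ln \<theta> * \<bar>u $ i - v $ i\<bar>)"
    using coord mem assms(3,4) by (intro sum_mono) (simp add: real_norm_def)
  also have "\<dots> = - ln \<theta> * norm1 (u - v)"
    by (simp add: norm1_def sum_distrib_left)
  finally show ?thesis .
qed

lemma continuous_on_entropy_reg:
  assumes "0 < \<theta>"
  shows "continuous_on (trunc_simplex \<theta>) (entropy_reg :: real ^ 'd \<Rightarrow> real)"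
  unfolding entropy_reg_def using assms
  by (intro continuous_intros) (auto simp: trunc_simplex_def dest!: spec[where P = "\<lambda>i. \<theta> \<le> _ $ i"] intro!: less_imp_neq[THEN not_sym] intro: less_le_trans)

text \<open>The second derivative of the entropy along a segment of the simplex with direction
  \<open>h\<close> is \<open>\<Sum>i. h\<^sub>i\<^sup>2 / x\<^sub>i\<close>, which is at least \<open>(norm1 h)\<^sup>2\<close> by
  Cauchy-Schwarz.\<close>

lemma norm1_sq_le_sum_div:
  fixes h w :: "real ^ 'd"
  assumes "0 < \<theta>" "w \<in> trunc_simplex \<theta>"
  shows "(norm1 h)\<^sup>2 \<le> (\<Sum>i\<in>UNIV. (h $ i)\<^sup>2 / w $ i)"
proof -
  have w: "sum (($) w) UNIV = 1" "\<And>i. 0 < w $ i"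
    using assms by (auto simp: trunc_simplex_eq intro: less_le_trans)
  have "(\<Sum>i\<in>UNIV. (\<bar>h $ i\<bar> / sqrt (w $ i)) * sqrt (w $ i))\<^sup>2
      \<le> (\<Sum>i\<in>UNIV. (\<bar>h $ i\<bar> / sqrt (w $ i))\<^sup>2) * (\<Sum>i\<in>UNIV. (sqrt (w $ i))\<^sup>2)"
    by (rule Cauchy_Schwarz_ineq_sum)
  moreover have "\<bar>h $ i\<bar> / sqrt (w $ i) * sqrt (w $ i) = \<bar>h $ i\<bar>" for i
    using w(2)[of i] by simp
  ultimately show ?thesis
    using w(1) less_imp_le[OF w(2)] by (simp add: norm1_def power_divide)
qed

section \<open>Quadratic growth and continuity of entropy-regularised minimisers\<close>

text \<open>Second-order Taylor expansion along the segment from \<open>u\<close> to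
  \<open>v\<close>: the slope at \<open>u\<close> is nonnegative by minimality, and the second
  derivative is at least \<open>c\<close> times the squared 1-norm of \<open>v - u\<close>.\<close>

lemma entropy_minimiser_gap:
  fixes a u v :: "real ^ 'd"
  assumes "0 < \<theta>" "0 \<le> c" "u \<in> trunc_simplex \<theta>" "v \<in> trunc_simplex \<theta>"
    and min: "\<And>w. w \<in> trunc_simplex \<theta> \<Longrightarrow> a \<bullet> u + c * entropy_reg u \<le> a \<bullet> w + c * entropy_reg w"
  shows "c / 2 * (norm1 (v - u))\<^sup>2 \<le> (a \<bullet> v + c * entropy_reg v) - (a \<bullet> u + c * entropy_reg u)"
proof -
  define h where "h = v - u"
  define p where "p s = u + s *\<^sub>R h" for s
  define \<phi> where "\<phi> s = a \<bullet> p s + c * entropy_reg (p s)" for s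
  define \<phi>' where "\<phi>' s = a \<bullet> h + c * (\<Sum>i\<in>UNIV. h $ i * ln (p s $ i) + h $ i)" for s
  define \<phi>'' where "\<phi>'' s = c * (\<Sum>i\<in>UNIV. (h $ i)\<^sup>2 / p s $ i)" for s
  have p_in: "p s \<in> trunc_simplex \<theta>" if "0 \<le> s" "s \<le> 1" for s
  proof -
    have "p s = (1 - s) *\<^sub>R u + s *\<^sub>R v"
      by (simp add: p_def h_def algebra_simps)
    then show ?thesis
      using convexD[OF convex_trunc_simplex[of \<theta>], of u v "1 - s" s] assms that by simp
  qed
  have p_pos: "0 < p s $ i" if "0 \<le> s" "s \<le> 1" for s i
    using p_in[OF that] assms(1) by (auto simp: trunc_simplex_def intro: less_le_trans)
  have dp: "((\<lambda>s. p s $ i) has_real_derivative h $ i) (at s)" for s i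
    unfolding p_def by (auto intro!: derivative_eq_intros)
  \<comment> \<open>Coordinates of \<open>p s\<close> are strictly positive also at the endpoints,
    so two-sided derivatives exist on all of [0, 1].\<close>
  have d1: "(\<phi> has_real_derivative \<phi>' s) (at s)" if "0 \<le> s" "s \<le> 1" for s
  proof -
    have "((\<lambda>s. \<Sum>i\<in>UNIV. p s $ i * ln (p s $ i)) has_real_derivative
        (\<Sum>i\<in>UNIV. h $ i * ln (p s $ i) + h $ i)) (at s)"
    proof (rule DERIV_sum)
      fix i
      show "((\<lambda>s. p s $ i * ln (p s $ i)) has_real_derivative h $ i * ln (p s $ i) + h $ i) (at s)"
        using p_pos[OF that, of i] by (auto intro!: derivative_eq_intros dp)
    qed
    moreover have "((\<lambda>s. a \<bullet> p s) has_real_derivative a \<bullet> h) (at s)"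
      unfolding p_def inner_add_right inner_scaleR_right by (auto intro!: derivative_eq_intros)
    ultimately have "((\<lambda>s. a \<bullet> p s + c * ((\<Sum>i\<in>UNIV. p s $ i * ln (p s $ i)) + ln (real CARD('d))))
        has_real_derivative a \<bullet> h + c * ((\<Sum>i\<in>UNIV. h $ i * ln (p s $ i) + h $ i) + 0)) (at s)"
      by (intro DERIV_add DERIV_cmult DERIV_const)
    then show ?thesis
      unfolding \<phi>_def \<phi>'_def entropy_reg_def by simp
  qed
  have d2: "(\<phi>' has_real_derivative \<phi>'' s) (at s)" if "0 \<le> s" "s \<le> 1" for s
  proof -
    have "((\<lambda>s. \<Sum>i\<in>UNIV. h $ i * ln (p s $ i) + h $ i) has_real_derivative
        (\<Sum>i\<in>UNIV. (h $ i)\<^sup>2 / p s $ i)) (at s)"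
    proof (rule DERIV_sum)
      fix i
      show "((\<lambda>s. h $ i * ln (p s $ i) + h $ i) has_real_derivative (h $ i)\<^sup>2 / p s $ i) (at s)"
        using p_pos[OF that, of i] by (auto intro!: derivative_eq_intros dp simp: power2_eq_square)
    qed
    then have "((\<lambda>s. a \<bullet> h + c * (\<Sum>i\<in>UNIV. h $ i * ln (p s $ i) + h $ i)) has_real_derivative
        0 + c * (\<Sum>i\<in>UNIV. (h $ i)\<^sup>2 / p s $ i)) (at s)"
      by (intro DERIV_add DERIV_cmult DERIV_const)
    then show ?thesis
      unfolding \<phi>'_def \<phi>''_def by simp
  qed
  \<comment> \<open>Taylor's formula at 1 with Lagrange remainder of order 2; the conditional lists
    the function and its first two derivatives by index.\<close>
  have "\<exists>t>0. t < 1 \<and> \<phi> 1 = (\<Sum>m<2. (if m = 0 then \<phi> else if m = 1 then \<phi>' else \<phi>'') 0 / fact m * 1 ^ m)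
      + (if (2::nat) = 0 then \<phi> else if (2::nat) = 1 then \<phi>' else \<phi>'') t / fact 2 * 1 ^ 2"
    by (rule Maclaurin) (auto simp: less_2_cases_iff d1 d2)
  then obtain t where t: "0 < t" "t < 1" "\<phi> 1 = \<phi> 0 + \<phi>' 0 + \<phi>'' t / 2"
    by (auto simp: numeral_2_eq_2)
  have "0 \<le> \<phi>' 0"
  proof (rule ccontr)
    assume "\<not> 0 \<le> \<phi>' 0"
    then obtain d where d: "0 < d" "\<And>s. 0 < s \<Longrightarrow> s < d \<Longrightarrow> \<phi> s < \<phi> 0"
      using DERIV_neg_dec_right[OF d1[of 0]] by auto
    \<comment> \<open>Small enough for the strict decrease and still on the segment, so it
      contradicts minimality.\<close>
    let ?s = "min (d / 2) 1"
    have "\<phi> ?s < \<phi> 0" using d by auto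
    moreover have "\<phi> 0 \<le> \<phi> ?s"
      using min[OF p_in[of ?s]] d(1) by (simp add: \<phi>_def p_def)
    ultimately show False by simp
  qed
  moreover have "c * (norm1 h)\<^sup>2 \<le> \<phi>'' t"
    unfolding \<phi>''_def using norm1_sq_le_sum_div[OF assms(1) p_in] t assms(2)
    by (intro mult_left_mono) auto
  ultimately have "c / 2 * (norm1 h)\<^sup>2 \<le> \<phi> 1 - \<phi> 0"
    using t(3) by simp
  then show ?thesis
    by (simp add: \<phi>_def p_def h_def)
qed

lemma entropy_minimiser_exists:
  fixes a :: "real ^ 'd"
  assumes "0 < \<theta>" "\<theta> \<le> 1 / real CARD('d)"
  shows "\<exists>u\<in>trunc_simplex \<theta>. \<forall>w\<in>trunc_simplex \<theta>. a \<bullet> u + c * entropy_reg u \<le> a \<bullet> w + c * entropy_reg w"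
  using assms trunc_simplex_nonempty[of \<theta>, where 'd = 'd]
  by (intro continuous_attains_inf compact_trunc_simplex continuous_intros continuous_on_entropy_reg) auto

text \<open>Adding the growth inequalities of the minimisers for \<open>a\<close> and
  \<open>b\<close> cancels the entropies and leaves c |r b - r a|^2 \<le> (a - b) \<bullet> (r b - r
  a) in the Euclidean norm; Cauchy-Schwarz makes \<open>r\<close> Lipschitz with constant 1 /
  c.\<close>

lemma entropy_minimiser_continuous:
  fixes r :: "real ^ 'd \<Rightarrow> real ^ 'd"
  assumes "0 < \<theta>" "0 < c"
    and r: "\<And>a. r a \<in> trunc_simplex \<theta>"
    and min: "\<And>a w. w \<in> trunc_simplex \<theta> \<Longrightarrow>
      a \<bullet> r a + c * entropy_reg (r a) \<le> a \<bullet> w + c * entropy_reg w"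
  shows "continuous_on UNIV r"
proof -
  have "dist (r a) (r b) \<le> 1 / c * dist a b" for a b
  proof -
    let ?n = "norm (r b - r a)"
    have gap: "c / 2 * ?n\<^sup>2 \<le> c / 2 * (norm1 (r b - r a))\<^sup>2"
      using assms(2) norm_le_norm1 by (intro mult_left_mono power_mono) auto
    have "c / 2 * (norm1 (r b - r a))\<^sup>2
        \<le> (a \<bullet> r b + c * entropy_reg (r b)) - (a \<bullet> r a + c * entropy_reg (r a))"
      using assms by (intro entropy_minimiser_gap[of \<theta>]) auto
    moreover have "c / 2 * (norm1 (r a - r b))\<^sup>2
        \<le> (b \<bullet> r a + c * entropy_reg (r a)) - (b \<bullet> r b + c * entropy_reg (r b))"
      using assms by (intro entropy_minimiser_gap[of \<theta>]) auto
    ultimately have "c * ?n\<^sup>2 \<le> (a - b) \<bullet> (r b - r a)"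
      using gap by (simp add: norm1_minus_commute[of "r a"] algebra_simps)
    also have "\<dots> \<le> norm (a - b) * ?n"
      by (rule norm_cauchy_schwarz)
    finally have "?n * (c * ?n) \<le> ?n * norm (a - b)"
      by (simp add: power2_eq_square mult_ac)
    then have "c * ?n \<le> norm (a - b)"
      by (cases "?n = 0") (auto simp: mult_le_cancel_left)
    then show ?thesis
      using assms(2) by (simp add: dist_norm norm_minus_commute field_simps)
  qed
  then have "(1 / c)-lipschitz_on UNIV r"
    using assms(2) by (intro lipschitz_onI) auto
  then show ?thesis
    by (rule lipschitz_on_continuous_on)
qed

section \<open>Saddle points of the regularised games\<close>

lemma bilin_eq_inner_left: "bilin M u v = (M *v v) \<bullet> u"
  by (simp add: bilin_def inner_commute)

lemma bilin_eq_inner_right: "bilin M u v = (u v* M) \<bullet> v"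
  by (simp add: bilin_def dot_lmul_matrix)

text \<open>A fixed point of the best-response map, which strong convexity makes continuous, is
  a saddle point.\<close>

lemma ent_game_saddle_exists:
  fixes M :: "real ^ 'n ^ 'm"
  assumes "0 < \<theta>" "\<theta> \<le> 1 / real CARD('m)" "\<theta> \<le> 1 / real CARD('n)" "0 < c"
  shows "\<exists>x y. saddle (trunc_simplex \<theta>) (trunc_simplex \<theta>) (ent_game c M) x y"
proof -
  obtain r :: "real ^ 'm \<Rightarrow> real ^ 'm" where r: "\<And>a. r a \<in> trunc_simplex \<theta>"
    "\<And>a w. w \<in> trunc_simplex \<theta> \<Longrightarrow> a \<bullet> r a + c * entropy_reg (r a) \<le> a \<bullet> w + c * entropy_reg w"
    using entropy_minimiser_exists[OF assms(1,2), of _ c] by metis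
  obtain q :: "real ^ 'n \<Rightarrow> real ^ 'n" where q: "\<And>a. q a \<in> trunc_simplex \<theta>"
    "\<And>a w. w \<in> trunc_simplex \<theta> \<Longrightarrow> a \<bullet> q a + c * entropy_reg (q a) \<le> a \<bullet> w + c * entropy_reg w"
    using entropy_minimiser_exists[OF assms(1,3), of _ c] by metis
  let ?K = "trunc_simplex \<theta> \<times> trunc_simplex \<theta> :: ((real ^ 'm) \<times> (real ^ 'n)) set"
  \<comment> \<open>The maximiser's best response minimises the negated payoff, hence the minus sign
    in the argument of \<open>q\<close>.\<close>
  define g where "g z = (r (M *v snd z), q (- (fst z v* M)))" for z
  have mult: "continuous_on ?K (\<lambda>z. M *v snd z)" "continuous_on ?K (\<lambda>z. - (fst z v* M))"
    \<comment> \<open>Writing \<open>v*\<close> as multiplication by the transpose brings both maps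
      under the continuity of matrix-vector products.\<close>
    unfolding transpose_matrix_vector[symmetric]
    by (intro continuous_on_minus continuous_on_fst continuous_on_snd continuous_on_id subset_UNIV
        continuous_on_compose2[OF matrix_vector_mult_linear_continuous_on[where S = UNIV]])+
  have "continuous_on ?K g"
    unfolding g_def
    by (intro continuous_on_Pair continuous_on_compose2[OF entropy_minimiser_continuous[OF assms(1,4) r]]
        continuous_on_compose2[OF entropy_minimiser_continuous[OF assms(1,4) q]] mult) auto
  moreover have "g \<in> ?K \<rightarrow> ?K"
    by (auto simp: g_def r q)
  moreover have "compact ?K" "convex ?K" "?K \<noteq> {}"
    using assms trunc_simplex_nonempty[of \<theta>, where 'd = 'm] trunc_simplex_nonempty[of \<theta>, where 'd = 'n]
    by (auto intro!: compact_Times compact_trunc_simplex convex_Times convex_trunc_simplex)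
  ultimately obtain z where "z \<in> ?K" "g z = z"
    using brouwer[of ?K g] by blast
  then have "r (M *v snd z) = fst z" "q (- (fst z v* M)) = snd z"
    by (auto simp: g_def prod_eq_iff)
  then obtain x y where xy: "r (M *v y) = x" "q (- (x v* M)) = y"
    by blast
  have "saddle (trunc_simplex \<theta>) (trunc_simplex \<theta>) (ent_game c M) x y"
    unfolding saddle_def
  proof (intro conjI ballI)
    show "x \<in> trunc_simplex \<theta>" "y \<in> trunc_simplex \<theta>"
      using r(1)[of "M *v y"] q(1)[of "- (x v* M)"] xy by auto
    show "ent_game c M x y \<le> ent_game c M u y" if "u \<in> trunc_simplex \<theta>" for u
      using r(2)[OF that, of "M *v y"] xy by (simp add: ent_game_def bilin_eq_inner_left)
    show "ent_game c M x v \<le> ent_game c M x y" if "v \<in> trunc_simplex \<theta>" for v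
      using q(2)[OF that, of "- (x v* M)"] xy by (simp add: ent_game_def bilin_eq_inner_right)
  qed
  then show ?thesis by blast
qed

text \<open>Each player's strategy minimises a linear functional plus entropy when the other is
  fixed. The two growth inequalities are added and the saddle value cancels.\<close>

lemma ent_game_saddle_gap:
  assumes "0 < \<theta>" "0 \<le> c"
    and sad: "saddle (trunc_simplex \<theta>) (trunc_simplex \<theta>) (ent_game c M) x y"
    and "u \<in> trunc_simplex \<theta>" "v \<in> trunc_simplex \<theta>"
  shows "c / 2 * ((norm1 (u - x))\<^sup>2 + (norm1 (v - y))\<^sup>2) \<le> ent_game c M u y - ent_game c M x v"
proof -
  have "c / 2 * (norm1 (u - x))\<^sup>2
      \<le> ((M *v y) \<bullet> u + c * entropy_reg u) - ((M *v y) \<bullet> x + c * entropy_reg x)"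
    using assms by (intro entropy_minimiser_gap[of \<theta>])
      (auto simp: saddle_def ent_game_def bilin_eq_inner_left)
  moreover have "c / 2 * (norm1 (v - y))\<^sup>2
      \<le> ((- (x v* M)) \<bullet> v + c * entropy_reg v) - ((- (x v* M)) \<bullet> y + c * entropy_reg y)"
    using assms by (intro entropy_minimiser_gap[of \<theta>])
      (auto simp: saddle_def ent_game_def bilin_eq_inner_right)
  moreover have "(M *v y) \<bullet> x = (x v* M) \<bullet> y"
    by (metis bilin_eq_inner_left bilin_eq_inner_right)
  ultimately show ?thesis
    by (simp add: ent_game_def bilin_eq_inner_left[of M u] bilin_eq_inner_right[of M x] distrib_left)
qed

text \<open>Minimax and maximin strategies found separately pair up because some saddle exists: its
  value V bounds \<open>S x v\<close> from above for all \<open>v\<close> and \<open>S u y\<close>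
  from below for all \<open>u\<close>. Boundedness gives the real SUP and INF their meaning.\<close>

lemma saddle_of_arg_opt:
  fixes S :: "'a \<Rightarrow> 'b \<Rightarrow> real"
  assumes sad: "saddle X Y S x0 y0"
    and bdd: "\<And>u. u \<in> X \<Longrightarrow> bdd_above (S u ` Y)" "\<And>v. v \<in> Y \<Longrightarrow> bdd_below ((\<lambda>u. S u v) ` X)"
    and x: "is_arg_min (\<lambda>u. SUP v\<in>Y. S u v) (\<lambda>u. u \<in> X) x"
    and y: "is_arg_max (\<lambda>v. INF u\<in>X. S u v) (\<lambda>v. v \<in> Y) y"
  shows "saddle X Y S x y"
proof -
  have in0: "x0 \<in> X" "y0 \<in> Y" and inxy: "x \<in> X" "y \<in> Y"
    using sad x y by (auto simp: saddle_def is_arg_min_def is_arg_max_def)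
  have "(SUP v\<in>Y. S x v) \<le> (SUP v\<in>Y. S x0 v)"
    using x in0 by (auto simp: is_arg_min_linorder)
  also have "\<dots> \<le> S x0 y0"
    using sad in0 by (intro cSUP_least) (auto simp: saddle_def)
  finally have 1: "S x v \<le> S x0 y0" if "v \<in> Y" for v
    using cSUP_upper[OF that bdd(1)[OF inxy(1)]] by linarith
  have "S x0 y0 \<le> (INF u\<in>X. S u y0)"
    using sad in0 by (intro cINF_greatest) (auto simp: saddle_def)
  also have "\<dots> \<le> (INF u\<in>X. S u y)"
    using y in0 by (auto simp: is_arg_max_linorder)
  finally have 2: "S x0 y0 \<le> S u y" if "u \<in> X" for u
    using cINF_lower[OF bdd(2)[OF inxy(2)] that] by linarith
  show ?thesis
    \<comment> \<open>Both bounds at (\<open>x\<close>, \<open>y\<close>) force \<open>S x y\<close>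
      to equal the value of the given saddle.\<close>
    unfolding saddle_def using 1 2 inxy by (meson order_trans)
qed

section \<open>Boundedness, additivity and Lipschitz estimates of the payoffs\<close>

lemma continuous_on_bilin:
  "continuous_on S (bilin M u)" "continuous_on S' (\<lambda>u. bilin M u v)"
  unfolding bilin_def[abs_def] by (intro continuous_intros)+

lemma bdd_above_bilin: "bdd_above (bilin M u ` trunc_simplex \<theta>)"
  by (intro bounded_imp_bdd_above compact_imp_bounded compact_continuous_image
      continuous_on_bilin compact_trunc_simplex)

lemma ent_game_bdd:
  assumes "0 < \<theta>"
  shows "bdd_above (ent_game c M u ` trunc_simplex \<theta>)" "bdd_below ((\<lambda>u. ent_game c M u v) ` trunc_simplex \<theta>)"
  unfolding ent_game_def
  by (intro bounded_imp_bdd_above bounded_imp_bdd_below compact_imp_bounded compact_continuous_image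
      continuous_intros continuous_on_bilin continuous_on_entropy_reg compact_trunc_simplex assms)+


lemma ent_game_add:
  "ent_game (c + d) (M + N) u v = ent_game c M u v + ent_game d N u v"
  by (simp add: ent_game_def bilin_def matrix_vector_mult_add_rdistrib inner_add_right algebra_simps)

lemma bilin_sum: "bilin (\<Sum>t\<in>I. A t) u v = (\<Sum>t\<in>I. bilin (A t) u v)"
  by (induction I rule: infinite_finite_induct)
    (simp_all add: bilin_def matrix_vector_mult_add_rdistrib inner_add_right)

lemma sum_reg_payoff:
  "(\<Sum>\<tau>=1..t. reg_payoff \<eta> (A \<tau>) u v) = ent_game (real t / \<eta>) (\<Sum>\<tau>=1..t. A \<tau>) u v"
  by (simp add: reg_payoff_def ent_game_def bilin_sum sum.distrib sum_subtractf)

text \<open>Both entropies are nonnegative and at most the logarithm of their dimension, so their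
  difference costs the larger logarithm and not the sum.\<close>

lemma ent_game_bilin_diff:
  fixes M :: "real ^ 'n ^ 'm"
  assumes "0 < \<theta>" "0 \<le> c" "u \<in> trunc_simplex \<theta>" "v \<in> trunc_simplex \<theta>"
  shows "\<bar>ent_game c M u v - bilin M u v\<bar> \<le> c * max (ln (real CARD('m))) (ln (real CARD('n)))"
proof -
  have "\<bar>entropy_reg u - entropy_reg v\<bar> \<le> max (ln (real CARD('m))) (ln (real CARD('n)))"
    using entropy_reg_nonneg[OF assms(1,3)] entropy_reg_nonneg[OF assms(1,4)]
      entropy_reg_le[OF assms(1,3)] entropy_reg_le[OF assms(1,4)] by linarith
  then have "c * \<bar>entropy_reg u - entropy_reg v\<bar> \<le> c * max (ln (real CARD('m))) (ln (real CARD('n)))"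
    using assms(2) by (rule mult_left_mono)
  moreover have "\<bar>ent_game c M u v - bilin M u v\<bar> = c * \<bar>entropy_reg u - entropy_reg v\<bar>"
    using assms(2) by (simp add: ent_game_def abs_mult flip: right_diff_distrib)
  ultimately show ?thesis by simp
qed

lemma lipschitz_norm1_onD:
  assumes "lipschitz_norm1_on G X Y L" "u \<in> X" "u' \<in> X" "v \<in> Y" "v' \<in> Y"
  shows "\<bar>L u v - L u' v'\<bar> \<le> G * (norm1 (u - u') + norm1 (v - v'))"
  using assms unfolding lipschitz_norm1_on_def norm1_vconcat_diff by blast

lemma lipschitz_norm1_on_bilin_sum:
  assumes "\<And>t. t \<in> I \<Longrightarrow> lipschitz_norm1_on G X Y (bilin (A t))"
  shows "lipschitz_norm1_on (real (card I) * G) X Y (bilin (\<Sum>t\<in>I. A t))"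
  unfolding lipschitz_norm1_on_def
proof (intro ballI)
  fix u v u' v' assume *: "u \<in> X" "v \<in> Y" "u' \<in> X" "v' \<in> Y"
  have "\<bar>bilin (\<Sum>t\<in>I. A t) u v - bilin (\<Sum>t\<in>I. A t) u' v'\<bar>
      \<le> (\<Sum>t\<in>I. \<bar>bilin (A t) u v - bilin (A t) u' v'\<bar>)"
    unfolding bilin_sum sum_subtractf[symmetric] by (rule sum_abs)
  also have "\<dots> \<le> (\<Sum>t\<in>I. G * norm1 (vconcat u v - vconcat u' v'))"
    using assms * by (intro sum_mono) (auto simp: lipschitz_norm1_on_def)
  finally show "\<bar>bilin (\<Sum>t\<in>I. A t) u v - bilin (\<Sum>t\<in>I. A t) u' v'\<bar>
      \<le> real (card I) * G * norm1 (vconcat u v - vconcat u' v')"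
    by simp
qed

text \<open>The bilinear part contributes \<open>G\<close> and each entropy c |ln \<theta>| in its
  own argument. With the parameters of the algorithm and \<open>c\<close> = 1 / \<eta> the constant
  becomes 2 G.\<close>

lemma ent_game_lipschitz:
  assumes "0 < \<theta>" "\<theta> \<le> exp (- 1)" "0 \<le> c"
    and lip: "lipschitz_norm1_on G prob_simplex prob_simplex (bilin M)"
    and mem: "u \<in> trunc_simplex \<theta>" "u' \<in> trunc_simplex \<theta>" "v \<in> trunc_simplex \<theta>" "v' \<in> trunc_simplex \<theta>"
  shows "\<bar>ent_game c M u v - ent_game c M u' v'\<bar> \<le> (G - c * ln \<theta>) * (norm1 (u - u') + norm1 (v - v'))"
proof -
  have "\<bar>bilin M u v - bilin M u' v'\<bar> \<le> G * (norm1 (u - u') + norm1 (v - v'))"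
    using mem assms(1)
    by (intro lipschitz_norm1_onD[OF lip] subsetD[OF trunc_simplex_subset_prob]) (auto dest: less_imp_le)
  moreover have "c * \<bar>entropy_reg u - entropy_reg u'\<bar> \<le> c * (- ln \<theta> * norm1 (u - u'))"
    "c * \<bar>entropy_reg v - entropy_reg v'\<bar> \<le> c * (- ln \<theta> * norm1 (v - v'))"
    using assms by (intro mult_left_mono entropy_reg_lipschitz; simp)+
  moreover have "\<bar>ent_game c M u v - ent_game c M u' v'\<bar> \<le> \<bar>bilin M u v - bilin M u' v'\<bar>
      + c * \<bar>entropy_reg u - entropy_reg u'\<bar> + c * \<bar>entropy_reg v - entropy_reg v'\<bar>"
  proof -
    have "ent_game c M u v - ent_game c M u' v' = (bilin M u v - bilin M u' v')
        + c * (entropy_reg u - entropy_reg u') - c * (entropy_reg v - entropy_reg v')"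
      by (simp add: ent_game_def algebra_simps)
    moreover have "\<bar>a + b - d\<bar> \<le> \<bar>a\<bar> + \<bar>b\<bar> + \<bar>d\<bar>" for a b d :: real
      by linarith
    ultimately show ?thesis
      using assms(3) by (metis abs_mult abs_of_nonneg)
  qed
  ultimately show ?thesis by (simp add: algebra_simps)
qed

section \<open>Movement of saddle points and growth of the saddle value\<close>

text \<open>Each saddle is tested at the other one. In the sum of the two growth inequalities the
  old payoff cancels, so only the increment \<open>N\<close> remains on the right; then (a + b)^2
  \<le> 2 (a^2 + b^2) and division by a + b give the factor 4.\<close>

lemma ent_game_saddle_stability:
  assumes "0 < \<theta>" "0 \<le> c" "0 \<le> k" "0 \<le> K"
    and sad: "saddle (trunc_simplex \<theta>) (trunc_simplex \<theta>) (ent_game c M) x y"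
      "saddle (trunc_simplex \<theta>) (trunc_simplex \<theta>) (ent_game (c + k) (M + N)) x' y'"
    and lip: "ent_game k N x y' - ent_game k N x' y \<le> K * (norm1 (x' - x) + norm1 (y' - y))"
  shows "(2 * c + k) * (norm1 (x' - x) + norm1 (y' - y)) \<le> 4 * K"
proof -
  let ?a = "norm1 (x' - x)" and ?b = "norm1 (y' - y)"
  have "c / 2 * (?a\<^sup>2 + ?b\<^sup>2) \<le> ent_game c M x' y - ent_game c M x y'"
    using assms by (intro ent_game_saddle_gap) (auto simp: saddle_def)
  moreover have "(c + k) / 2 * (?a\<^sup>2 + ?b\<^sup>2) \<le> ent_game (c + k) (M + N) x y' - ent_game (c + k) (M + N) x' y"
    unfolding norm1_minus_commute[of x'] norm1_minus_commute[of y']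
    using assms by (intro ent_game_saddle_gap) (auto simp: saddle_def)
  ultimately have "(2 * c + k) / 2 * (?a\<^sup>2 + ?b\<^sup>2) \<le> K * (?a + ?b)"
    using lip by (simp add: ent_game_add field_simps)
  moreover have "(2 * c + k) / 2 * ((?a + ?b)\<^sup>2 / 2) \<le> (2 * c + k) / 2 * (?a\<^sup>2 + ?b\<^sup>2)"
    using assms sum_squares_bound[of ?a ?b] by (intro mult_left_mono) (auto simp: power2_sum)
  ultimately have "(2 * c + k) / 2 * ((?a + ?b)\<^sup>2 / 2) \<le> K * (?a + ?b)"
    by linarith
  then have "(?a + ?b) * ((2 * c + k) * (?a + ?b)) \<le> (?a + ?b) * (4 * K)"
    by (simp add: power2_eq_square mult_ac)
  moreover have "0 \<le> ?a + ?b"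
    by (simp add: norm1_ge_0)
  ultimately show ?thesis
    using assms(4) by (cases "?a + ?b = 0") (auto simp: mult_le_cancel_left)
qed

text \<open>Induction on the saddle value. The point with index \<open>Suc t\<close> is a saddle of
  \<open>S t\<close>, so \<open>L t\<close> is played at the saddle of the preceding sum, and the
  first point belongs to the zero game.\<close>

lemma saddle_leader_regret:
  fixes S L :: "nat \<Rightarrow> 'a \<Rightarrow> 'b \<Rightarrow> real"
  assumes S0: "\<And>u v. S 0 u v = 0"
    and S_Suc: "\<And>t u v. S (Suc t) u v = S t u v + L (Suc t) u v"
    and sad: "\<And>t. t \<le> T \<Longrightarrow> saddle X Y (S t) (x (Suc t)) (y (Suc t))"
    and near: "\<And>t. t \<in> {1..T} \<Longrightarrow> \<bar>L t (x (Suc t)) (y t) - L t (x t) (y t)\<bar> \<le> \<delta> t"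
      "\<And>t. t \<in> {1..T} \<Longrightarrow> \<bar>L t (x t) (y (Suc t)) - L t (x t) (y t)\<bar> \<le> \<delta> t"
  shows "\<bar>S T (x (Suc T)) (y (Suc T)) - (\<Sum>t=1..T. L t (x t) (y t))\<bar> \<le> (\<Sum>t=1..T. \<delta> t)"
  using sad near
proof (induction T)
  case 0
  then show ?case by (simp add: S0)
next
  case (Suc T)
  let ?x = "x (Suc T)" and ?y = "y (Suc T)" and ?x' = "x (Suc (Suc T))" and ?y' = "y (Suc (Suc T))"
  have old: "saddle X Y (S T) ?x ?y" and new: "saddle X Y (S (Suc T)) ?x' ?y'"
    using Suc.prems(1)[of T] Suc.prems(1)[of "Suc T"] by auto
  \<comment> \<open>At the mixed point (\<open>?x'\<close>, \<open>?y\<close>) the old saddle bounds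
    \<open>S T\<close> from below and the new one bounds \<open>S (Suc T)\<close> from above; the
    other mixed point gives the reverse estimate.\<close>
  have "S T ?x ?y + L (Suc T) ?x' ?y \<le> S (Suc T) ?x' ?y"
    using old new by (auto simp: saddle_def S_Suc)
  also have "\<dots> \<le> S (Suc T) ?x' ?y'"
    using old new by (auto simp: saddle_def)
  finally have 1: "S T ?x ?y + L (Suc T) ?x' ?y \<le> S (Suc T) ?x' ?y'" .
  have "S (Suc T) ?x' ?y' \<le> S (Suc T) ?x ?y'"
    using old new by (auto simp: saddle_def)
  also have "\<dots> \<le> S T ?x ?y + L (Suc T) ?x ?y'"
    using old new by (auto simp: saddle_def S_Suc)
  finally have 2: "S (Suc T) ?x' ?y' \<le> S T ?x ?y + L (Suc T) ?x ?y'" .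
  have "\<bar>S T ?x ?y - (\<Sum>t=1..T. L t (x t) (y t))\<bar> \<le> (\<Sum>t=1..T. \<delta> t)"
    by (rule Suc.IH) (auto intro: Suc.prems)
  then show ?case
    using 1 2 Suc.prems(2)[of "Suc T"] Suc.prems(3)[of "Suc T"] by simp
qed

section \<open>Comparison with the value of the unregularised game on the full simplices\<close>

text \<open>The upper bound plays \<open>x\<close> in the infimum, the lower bound plays
  \<open>y\<close> in the supremum. The opponent is first moved into the truncated simplex (cost
  \<open>E\<close>), then the entropy is restored (cost \<open>R\<close>) and the saddle inequality
  applies.\<close>

lemma ent_game_value_approx:
  fixes M :: "real ^ 'n ^ 'm"
  assumes \<theta>: "0 < \<theta>" "\<theta> \<le> 1 / real CARD('m)" "\<theta> \<le> 1 / real CARD('n)" and "0 \<le> c" "0 \<le> K"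
    and lip: "lipschitz_norm1_on K prob_simplex prob_simplex (bilin M)"
    and sad: "saddle (trunc_simplex \<theta>) (trunc_simplex \<theta>) (ent_game c M) x y"
  shows "\<bar>ent_game c M x y - (INF u\<in>prob_simplex. SUP v\<in>prob_simplex. bilin M u v)\<bar>
    \<le> c * max (ln (real CARD('m))) (ln (real CARD('n))) + 2 * real (max CARD('m) CARD('n)) * K * \<theta>"
proof -
  let ?\<Delta>m = "prob_simplex :: (real ^ 'm) set" and ?\<Delta>n = "prob_simplex :: (real ^ 'n) set"
  let ?V = "ent_game c M x y"
  define R where "R = c * max (ln (real CARD('m))) (ln (real CARD('n)))"
  define E where "E = 2 * real (max CARD('m) CARD('n)) * K * \<theta>"
  have R: "\<bar>ent_game c M u v - bilin M u v\<bar> \<le> R"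
    if "u \<in> trunc_simplex \<theta>" "v \<in> trunc_simplex \<theta>" for u v
    using ent_game_bilin_diff[OF \<theta>(1) assms(4) that] unfolding R_def .
  have x: "x \<in> trunc_simplex \<theta>" "x \<in> ?\<Delta>m" and y: "y \<in> trunc_simplex \<theta>" "y \<in> ?\<Delta>n"
    using sad trunc_simplex_subset_prob[of \<theta>] \<theta>(1) by (auto simp: saddle_def)
  have E: "K * (2 * real CARD('m) * \<theta>) \<le> E" "K * (2 * real CARD('n) * \<theta>) \<le> E"
    unfolding E_def using assms(5) \<theta>(1) by (auto simp: mult_ac intro!: mult_left_mono)
  have upper: "bilin M x v \<le> ?V + (R + E)" if v: "v \<in> ?\<Delta>n" for v
  proof -
    obtain w where w: "w \<in> trunc_simplex \<theta>" "norm1 (v - w) \<le> 2 * real CARD('n) * \<theta>"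
      using trunc_simplex_approx[OF less_imp_le[OF \<theta>(1)] \<theta>(3) v] .
    have "\<bar>bilin M x v - bilin M x w\<bar> \<le> K * (norm1 (x - x) + norm1 (v - w))"
      using x v w trunc_simplex_subset_prob[of \<theta>] \<theta>(1) by (intro lipschitz_norm1_onD[OF lip]) auto
    also have "\<dots> \<le> K * (2 * real CARD('n) * \<theta>)"
      using w(2) assms(5) by (intro mult_left_mono) (auto simp: norm1_def)
    finally have "bilin M x v \<le> bilin M x w + E" using E(2) by linarith
    moreover have "bilin M x w \<le> ent_game c M x w + R"
      using R[OF x(1) w(1)] by linarith
    moreover have "ent_game c M x w \<le> ?V"
      using sad w(1) by (auto simp: saddle_def)
    ultimately show ?thesis by linarith
  qed
  have lower: "?V - (R + E) \<le> bilin M u y" if u: "u \<in> ?\<Delta>m" for u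
  proof -
    obtain w where w: "w \<in> trunc_simplex \<theta>" "norm1 (u - w) \<le> 2 * real CARD('m) * \<theta>"
      using trunc_simplex_approx[OF less_imp_le[OF \<theta>(1)] \<theta>(2) u] .
    have "\<bar>bilin M u y - bilin M w y\<bar> \<le> K * (norm1 (u - w) + norm1 (y - y))"
      using y u w trunc_simplex_subset_prob[of \<theta>] \<theta>(1) by (intro lipschitz_norm1_onD[OF lip]) auto
    also have "\<dots> \<le> K * (2 * real CARD('m) * \<theta>)"
      using w(2) assms(5) by (intro mult_left_mono) (auto simp: norm1_def)
    finally have "bilin M w y - E \<le> bilin M u y" using E(1) by linarith
    moreover have "ent_game c M w y - R \<le> bilin M w y"
      using R[OF w(1) y(1)] by linarith
    moreover have "?V \<le> ent_game c M w y"
      using sad w(1) by (auto simp: saddle_def)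
    ultimately show ?thesis by linarith
  qed
  \<comment> \<open>Besides bounding the infimum, this supplies the boundedness below that
    \<open>cINF_lower\<close> requires.\<close>
  have lower_sup: "?V - (R + E) \<le> (SUP v\<in>?\<Delta>n. bilin M u v)" if "u \<in> ?\<Delta>m" for u
    using lower[OF that] cSUP_upper[OF y(2), of "bilin M u"] bdd_above_bilin[of M u 0]
    by (simp add: prob_simplex_eq_trunc)
  then have "?V - (R + E) \<le> (INF u\<in>?\<Delta>m. SUP v\<in>?\<Delta>n. bilin M u v)"
    using x(2) by (intro cINF_greatest) auto
  moreover have "(INF u\<in>?\<Delta>m. SUP v\<in>?\<Delta>n. bilin M u v) \<le> (SUP v\<in>?\<Delta>n. bilin M x v)"
    using x(2) lower_sup by (intro cINF_lower bdd_belowI2)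
  moreover have "(SUP v\<in>?\<Delta>n. bilin M x v) \<le> ?V + (R + E)"
    using upper y(2) by (intro cSUP_least) auto
  ultimately show ?thesis
    unfolding R_def[symmetric] E_def[symmetric] by linarith
qed

text \<open>Telescoping: ln s \<le> s - 1 at s = n / (n + 1) gives 1 / (n + 1) \<le> ln (n + 1) - ln
  n.\<close>

lemma sum_inverse_le_ln:
  assumes "1 \<le> T"
  shows "(\<Sum>t=1..T. 1 / real t) \<le> 1 + ln (real T)"
  using assms
proof (induction T rule: dec_induct)
  case base
  then show ?case by simp
next
  case (step n)
  have "ln (real n / real (Suc n)) \<le> real n / real (Suc n) - 1"
    using step.hyps by (intro ln_le_minus_one) simp
  then have "1 / real (Suc n) \<le> ln (real (Suc n)) - ln (real n)"
    using step.hyps by (simp add: ln_div field_simps)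
  then show ?case
    using step.IH by simp
qed

section \<open>Regret of the algorithm\<close>

text \<open>For t = 0 the game is identically zero, so the arbitrary initial pair is a saddle; later
  iterates are saddles because one exists.\<close>

lemma omg_rftl_run_saddle:
  fixes A :: "nat \<Rightarrow> real ^ 'n ^ 'm"
  assumes \<theta>: "0 < \<theta>" "\<theta> \<le> 1 / real CARD('m)" "\<theta> \<le> 1 / real CARD('n)" and \<eta>: "0 < \<eta>"
    and run: "omg_rftl_run \<eta> \<theta> T A x y" and "t < T"
  shows "saddle (trunc_simplex \<theta>) (trunc_simplex \<theta>)
    (ent_game (real t / \<eta>) (\<Sum>\<tau>=1..t. A \<tau>)) (x (Suc t)) (y (Suc t))"
proof (cases "t = 0")
  case True
  then show ?thesis
    using run by (simp add: omg_rftl_run_def saddle_def ent_game_def bilin_def)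
next
  case False
  let ?S = "ent_game (real t / \<eta>) (\<Sum>\<tau>=1..t. A \<tau>)"
  have t: "t \<in> {1..<T}" and c: "0 < real t / \<eta>"
    using False \<open>t < T\<close> \<eta> by auto
  obtain x0 y0 where sad: "saddle (trunc_simplex \<theta>) (trunc_simplex \<theta>) ?S x0 y0"
    using ent_game_saddle_exists[OF \<theta> c] by blast
  have "is_arg_min (\<lambda>u. SUP v\<in>trunc_simplex \<theta>. ?S u v) (\<lambda>u. u \<in> trunc_simplex \<theta>) (x (Suc t))"
    "is_arg_max (\<lambda>v. INF u\<in>trunc_simplex \<theta>. ?S u v) (\<lambda>v. v \<in> trunc_simplex \<theta>) (y (Suc t))"
    using run t unfolding omg_rftl_run_def sum_reg_payoff by blast+
  from saddle_of_arg_opt[OF sad ent_game_bdd[OF \<theta>(1)] this] show ?thesis .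
qed

lemma omg_rftl_regret:
  fixes A :: "nat \<Rightarrow> real ^ 'n ^ 'm"
  assumes T: "1 \<le> T" and G: "0 < G" "G \<le> 1"
    and lip: "\<And>t. t \<in> {1..T} \<Longrightarrow> lipschitz_norm1_on G prob_simplex prob_simplex (bilin (A t))"
    and \<eta>: "\<eta> = sqrt (real T) / G" and \<theta>: "\<theta> = exp (- (\<eta> * G))"
    and \<theta>_le: "\<theta> \<le> 1 / real CARD('m)" "\<theta> \<le> 1 / real CARD('n)"
    and run: "omg_rftl_run \<eta> \<theta> T A x y"
  shows "\<bar>(\<Sum>t=1..T. bilin (A t) (x t) (y t))
      - (INF u\<in>prob_simplex. SUP v\<in>prob_simplex. \<Sum>t=1..T. bilin (A t) u v)\<bar>
    \<le> regret_bound G T CARD('m) CARD('n)"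
proof -
  let ?\<Delta> = "trunc_simplex \<theta>"
  let ?ln = "max (ln (real CARD('m))) (ln (real CARD('n)))"
  define S where "S t = ent_game (real t / \<eta>) (\<Sum>\<tau>=1..t. A \<tau>)" for t
  define L where "L t = ent_game (1 / \<eta>) (A t)" for t
  have sqrtT: "1 \<le> sqrt (real T)" using T by simp
  have \<eta>_pos: "0 < \<eta>" and \<eta>G: "\<eta> * G = sqrt (real T)"
    using \<eta> G T by auto
  have \<theta>_pos: "0 < \<theta>" and \<theta>_exp: "\<theta> \<le> exp (- 1)" and ln\<theta>: "1 / \<eta> * ln \<theta> = - G"
    using \<eta>G sqrtT \<eta>_pos by (auto simp: \<theta> field_simps simp flip: \<eta>G)
  have T\<eta>: "real T / \<eta> = G * sqrt (real T)"
  proof -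
    have "real T / \<eta> = G * (real T / sqrt (real T))"
      by (simp add: \<eta>)
    then show ?thesis
      by (simp add: real_div_sqrt)
  qed
  \<comment> \<open>The run prescribes iterates only up to round \<open>T\<close>, whereas the
    leader argument also uses the saddle of the full sum; it is appended at index
    \<open>Suc T\<close>, leaving rounds 1 to \<open>T\<close> unchanged.\<close>
  obtain xs ys where last: "saddle ?\<Delta> ?\<Delta> (S T) xs ys"
    using ent_game_saddle_exists[OF \<theta>_pos \<theta>_le, of "real T / \<eta>" "\<Sum>\<tau>=1..T. A \<tau>"] T \<eta>_pos
    unfolding S_def by auto
  define x' y' where "x' = x(Suc T := xs)" and "y' = y(Suc T := ys)"
  have sad: "saddle ?\<Delta> ?\<Delta> (S t) (x' (Suc t)) (y' (Suc t))" if "t \<le> T" for t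
    using last omg_rftl_run_saddle[OF \<theta>_pos \<theta>_le \<eta>_pos run, of t] that
    by (cases "t = T") (auto simp: S_def x'_def y'_def)
  have mem: "x' t \<in> ?\<Delta>" "y' t \<in> ?\<Delta>" if "t \<in> {1..Suc T}" for t
    using sad[of "t - 1"] that by (auto simp: saddle_def)
  have S_Suc: "S (Suc t) u v = S t u v + L (Suc t) u v" for t u v
  proof -
    have "real (Suc t) / \<eta> = real t / \<eta> + 1 / \<eta>"
      by (simp add: add_divide_distrib)
    then show ?thesis
      unfolding S_def L_def by (simp add: ent_game_add del: of_nat_Suc)
  qed
  \<comment> \<open>The constant is G + |ln \<theta>| / \<eta> = 2 G by the choice of
    \<theta>.\<close>
  have L_lip: "\<bar>L t u v - L t u' v'\<bar> \<le> 2 * G * (norm1 (u - u') + norm1 (v - v'))"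
    if "t \<in> {1..T}" "u \<in> ?\<Delta>" "u' \<in> ?\<Delta>" "v \<in> ?\<Delta>" "v' \<in> ?\<Delta>" for t u v u' v'
    using ent_game_lipschitz[OF \<theta>_pos \<theta>_exp _ lip[OF that(1)] that(2-5), where c = "1 / \<eta>"] \<eta>_pos
    unfolding L_def ln\<theta> by simp
  \<comment> \<open>Stability with weights n / \<eta> and 1 / \<eta>, where t = n + 1 \<le> 2 n + 1,
    bounds the displacement by 8 \<eta> G / t = 8 sqrt T / t; the factor 2 G turns this into a
    payoff error.\<close>
  have near: "2 * G * (norm1 (x' (Suc t) - x' t) + norm1 (y' (Suc t) - y' t)) \<le> 16 * G * sqrt (real T) * (1 / real t)"
    (is "2 * G * ?s \<le> _") if t: "t \<in> {1..T}" for t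
  proof -
    obtain n where n: "t = Suc n" using t by (cases t) auto
    have old: "saddle ?\<Delta> ?\<Delta> (ent_game (real n / \<eta>) (\<Sum>\<tau>=1..n. A \<tau>)) (x' t) (y' t)"
      using sad[of n] t by (simp add: S_def n)
    have new: "saddle ?\<Delta> ?\<Delta> (ent_game (real n / \<eta> + 1 / \<eta>) ((\<Sum>\<tau>=1..n. A \<tau>) + A t)) (x' (Suc t)) (y' (Suc t))"
      using sad[of t] t by (simp add: S_def n add_divide_distrib add.commute)
    have "L t (x' t) (y' (Suc t)) - L t (x' (Suc t)) (y' t) \<le> 2 * G * ?s"
      using L_lip[OF t mem(1) mem(1) mem(2) mem(2), of t "Suc t" "Suc t" t] t
      by (simp add: norm1_minus_commute[of "x' t"])
    then have "(2 * (real n / \<eta>) + 1 / \<eta>) * ?s \<le> 4 * (2 * G)"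
      using \<eta>_pos G by (intro ent_game_saddle_stability[OF \<theta>_pos _ _ _ old new]) (auto simp: L_def)
    moreover have "real t / \<eta> * ?s \<le> (2 * (real n / \<eta>) + 1 / \<eta>) * ?s"
      using \<eta>_pos by (intro mult_right_mono add_nonneg_nonneg norm1_ge_0) (auto simp: n field_simps)
    ultimately have "real t / \<eta> * ?s \<le> 8 * G" by linarith
    then have "?s \<le> 8 * (\<eta> * G) / real t"
      using \<eta>_pos t by (simp add: field_simps)
    then have "2 * G * ?s \<le> 2 * G * (8 * sqrt (real T) / real t)"
      unfolding \<eta>G using G by (intro mult_left_mono) auto
    then show ?thesis by (simp add: mult_ac)
  qed
  have "\<bar>S T (x' (Suc T)) (y' (Suc T)) - (\<Sum>t=1..T. L t (x' t) (y' t))\<bar>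
      \<le> (\<Sum>t=1..T. 16 * G * sqrt (real T) * (1 / real t))"
  proof (rule saddle_leader_regret[where S = S and L = L and x = x' and y = y' and X = ?\<Delta> and Y = ?\<Delta>])
    show "S (Suc t) u v = S t u v + L (Suc t) u v" for t u v
      by (rule S_Suc)
    show "saddle ?\<Delta> ?\<Delta> (S t) (x' (Suc t)) (y' (Suc t))" if "t \<le> T" for t
      using that by (rule sad)
    show "S 0 u v = 0" for u v
      by (simp add: S_def ent_game_def bilin_def)
    fix t assume t: "t \<in> {1..T}"
    have "\<bar>L t (x' (Suc t)) (y' t) - L t (x' t) (y' t)\<bar>
        \<le> 2 * G * (norm1 (x' (Suc t) - x' t) + norm1 (y' t - y' t))"
      using t by (intro L_lip mem) auto
    \<comment> \<open>Only one player moves here; the bound is enlarged to the joint displacement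
      controlled by \<open>near\<close>.\<close>
    also have "\<dots> \<le> 2 * G * (norm1 (x' (Suc t) - x' t) + norm1 (y' (Suc t) - y' t))"
      using G norm1_ge_0 by (intro mult_left_mono add_mono) (auto simp: norm1_def[of 0])
    finally show "\<bar>L t (x' (Suc t)) (y' t) - L t (x' t) (y' t)\<bar> \<le> 16 * G * sqrt (real T) * (1 / real t)"
      using near[OF t] by linarith
    have "\<bar>L t (x' t) (y' (Suc t)) - L t (x' t) (y' t)\<bar>
        \<le> 2 * G * (norm1 (x' t - x' t) + norm1 (y' (Suc t) - y' t))"
      using t by (intro L_lip mem) auto
    also have "\<dots> \<le> 2 * G * (norm1 (x' (Suc t) - x' t) + norm1 (y' (Suc t) - y' t))"
      using G norm1_ge_0 by (intro mult_left_mono add_mono) (auto simp: norm1_def[of 0])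
    finally show "\<bar>L t (x' t) (y' (Suc t)) - L t (x' t) (y' t)\<bar> \<le> 16 * G * sqrt (real T) * (1 / real t)"
      using near[OF t] by linarith
  qed
  also have "\<dots> = 16 * G * sqrt (real T) * (\<Sum>t=1..T. 1 / real t)"
    by (rule sum_distrib_left[symmetric])
  also have "\<dots> \<le> 16 * G * sqrt (real T) * (1 + ln (real T))"
    using G T by (intro mult_left_mono sum_inverse_le_ln) auto
  also have "\<dots> \<le> 32 * G * sqrt (real T) * (1 + ln (real T))"
    using G T by (intro mult_right_mono) auto
  finally have 1: "\<bar>S T xs ys - (\<Sum>t=1..T. L t (x' t) (y' t))\<bar> \<le> 32 * G * sqrt (real T) * (1 + ln (real T))"
    by (simp add: x'_def y'_def)
  have ln_nonneg: "0 \<le> ?ln" by (simp add: le_max_iff_disj)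
  \<comment> \<open>T / \<eta> = G sqrt T, and G \<le> 1.\<close>
  have reg: "real T / \<eta> * ?ln \<le> sqrt (real T) * ?ln"
    unfolding T\<eta> using G ln_nonneg by (intro mult_right_mono mult_left_le_one_le) auto
  have "\<bar>(\<Sum>t=1..T. L t (x' t) (y' t)) - (\<Sum>t=1..T. bilin (A t) (x t) (y t))\<bar>
      = \<bar>\<Sum>t=1..T. L t (x' t) (y' t) - bilin (A t) (x' t) (y' t)\<bar>"
    unfolding sum_subtractf by (intro arg_cong[where f = abs] arg_cong2[where f = minus] sum.cong)
      (auto simp: x'_def y'_def)
  also have "\<dots> \<le> (\<Sum>t=1..T. \<bar>L t (x' t) (y' t) - bilin (A t) (x' t) (y' t)\<bar>)"
    by (rule sum_abs)
  also have "\<dots> \<le> (\<Sum>t=1..T. 1 / \<eta> * ?ln)"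
    unfolding L_def using \<theta>_pos \<eta>_pos mem by (intro sum_mono ent_game_bilin_diff[of \<theta>]) auto
  finally have 2: "\<bar>(\<Sum>t=1..T. L t (x' t) (y' t)) - (\<Sum>t=1..T. bilin (A t) (x t) (y t))\<bar> \<le> sqrt (real T) * ?ln"
    using reg by simp
  have \<theta>_eq: "\<theta> = exp (- sqrt (real T))"
    unfolding \<theta> \<eta>G ..
  have "lipschitz_norm1_on (real T * G) prob_simplex prob_simplex (bilin (\<Sum>t=1..T. A t))"
    using lipschitz_norm1_on_bilin_sum[OF lip, of "{1..T}" "\<lambda>t. t"] by simp
  from ent_game_value_approx[OF \<theta>_pos \<theta>_le _ _ this last[unfolded S_def]]
  have "\<bar>S T xs ys - (INF u\<in>prob_simplex. SUP v\<in>prob_simplex. bilin (\<Sum>t=1..T. A t) u v)\<bar>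
      \<le> real T / \<eta> * ?ln + 2 * real (max CARD('m) CARD('n)) * (real T * G) * \<theta>"
    unfolding S_def using \<eta>_pos G by simp
  from order_trans[OF this add_right_mono[OF reg]]
  have 3: "\<bar>S T xs ys - (INF u\<in>prob_simplex. SUP v\<in>prob_simplex. \<Sum>t=1..T. bilin (A t) u v)\<bar>
      \<le> sqrt (real T) * ?ln + 2 * real (max CARD('m) CARD('n)) * (real T * G) * exp (- sqrt (real T))"
    unfolding bilin_sum \<theta>_eq .
  \<comment> \<open>Triangle inequality through the saddle value s and the regularised payoff l. The
    entropy cost q enters once for the iterates and once for the value.\<close>
  have "\<bar>b - w\<bar> \<le> p + 2 * q + r" if "\<bar>s - l\<bar> \<le> p" "\<bar>l - b\<bar> \<le> q" "\<bar>s - w\<bar> \<le> q + r"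
    for b w s l p q r :: real
    using that by linarith
  from this[OF 1 2 3] show ?thesis
    by (simp only: regret_bound_def mult_ac)
qed

section \<open>Asymptotics of the bound, uniform in the parameters\<close>

text \<open>The product filter asks for one predicate on each factor: the uniform statement serves
  for \<open>T\<close>, the admissible set itself for the parameters.\<close>

lemma eventually_unif_at_topI:
  assumes "\<forall>\<^sub>F T in sequentially. \<forall>G d1 d2. 0 < G \<and> G \<le> 1 \<and> 1 \<le> d1 \<and> 1 \<le> d2 \<longrightarrow> P (T, G, d1, d2)"
  shows "eventually P unif_at_top"
  unfolding unif_at_top_def eventually_prod_filter
  using assms
  by (intro exI[of _ "\<lambda>T. \<forall>G d1 d2. 0 < G \<and> G \<le> 1 \<and> 1 \<le> d1 \<and> 1 \<le> d2 \<longrightarrow> P (T, G, d1, d2)"]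
      exI[of _ "\<lambda>(G, d1, d2). 0 < G \<and> G \<le> 1 \<and> 1 \<le> d1 \<and> 1 \<le> d2"])
    (auto simp: eventually_principal)

lemma regret_bound_asymptotics:
  "\<exists>f e :: nat \<times> real \<times> nat \<times> nat \<Rightarrow> real.
      (\<forall>T G d1 d2. 1 \<le> T \<and> 0 < G \<and> G \<le> 1 \<and> 1 \<le> d1 \<and> 1 \<le> d2 \<longrightarrow>
         regret_bound G T d1 d2 = f (T, G, d1, d2) + e (T, G, d1, d2) * real (max d1 d2))
    \<and> f \<in> O[unif_at_top](\<lambda>(T, G, d1, d2).
           ln (real T) * sqrt (real T) + sqrt (real T) * max (ln (real d1)) (ln (real d2)))
    \<and> e \<in> o[unif_at_top](\<lambda>_. 1)"
proof -
  define f :: "nat \<times> real \<times> nat \<times> nat \<Rightarrow> real" where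
    "f = (\<lambda>(T, G, d1, d2). 32 * G * sqrt (real T) * (1 + ln (real T))
      + 2 * sqrt (real T) * max (ln (real d1)) (ln (real d2)))"
  define e :: "nat \<times> real \<times> nat \<times> nat \<Rightarrow> real" where
    "e = (\<lambda>(T, G, d1, d2). 2 * G * real T * exp (- sqrt (real T)))"
  have "f \<in> O[unif_at_top](\<lambda>(T, G, d1, d2).
      ln (real T) * sqrt (real T) + sqrt (real T) * max (ln (real d1)) (ln (real d2)))"
  \<comment> \<open>Once ln T \<ge> 1, the factor 1 + ln T is at most 2 ln T, so the first term has
    coefficient 32 * 2.\<close>
  proof (intro bigoI[where c = 64] eventually_unif_at_topI)
    have "\<forall>\<^sub>F T in sequentially. 1 \<le> ln (real T)"
      by real_asymp
    then show "\<forall>\<^sub>F T in sequentially. \<forall>G d1 d2. 0 < G \<and> G \<le> 1 \<and> 1 \<le> d1 \<and> 1 \<le> d2 \<longrightarrow>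
      norm (f (T, G, d1, d2)) \<le> 64 * norm (case (T, G, d1, d2) of (T, G, d1, d2) \<Rightarrow>
        ln (real T) * sqrt (real T) + sqrt (real T) * max (ln (real d1)) (ln (real d2)))"
    proof (eventually_elim, intro allI impI)
      fix T d1 d2 :: nat and G :: real
      assume T: "1 \<le> ln (real T)" and *: "0 < G \<and> G \<le> 1 \<and> 1 \<le> d1 \<and> 1 \<le> d2"
      let ?s = "sqrt (real T)" and ?l = "max (ln (real d1)) (ln (real d2))"
      have l: "0 \<le> ?l" using * by (simp add: le_max_iff_disj)
      have "32 * G * ?s * (1 + ln (real T)) \<le> 32 * 1 * ?s * (2 * ln (real T))"
        using * T by (intro mult_mono) auto
      moreover have "0 \<le> 32 * G * ?s * (1 + ln (real T))" "0 \<le> ?s * ?l" "0 \<le> ln (real T) * ?s"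
        using * T l by auto
      ultimately show "norm (f (T, G, d1, d2)) \<le> 64 * norm (case (T, G, d1, d2) of (T, G, d1, d2) \<Rightarrow>
          ln (real T) * sqrt (real T) + sqrt (real T) * max (ln (real d1)) (ln (real d2)))"
        unfolding f_def prod.case real_norm_def by argo
    qed
  qed
  moreover have "e \<in> o[unif_at_top](\<lambda>_. 1)"
  proof (intro landau_o.smallI eventually_unif_at_topI)
    fix c :: real assume "0 < c"
    \<comment> \<open>As G \<le> 1, this function of \<open>T\<close> alone dominates
      \<open>e\<close>, which makes the convergence uniform.\<close>
    have "(\<lambda>T. 2 * real T * exp (- sqrt (real T))) \<longlonglongrightarrow> 0"
      by real_asymp
    then have "\<forall>\<^sub>F T in sequentially. 2 * real T * exp (- sqrt (real T)) < c"
      using \<open>0 < c\<close> by (rule order_tendstoD(2))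
    then show "\<forall>\<^sub>F T in sequentially. \<forall>G d1 d2. 0 < G \<and> G \<le> 1 \<and> 1 \<le> d1 \<and> 1 \<le> d2 \<longrightarrow>
      norm (e (T, G, d1, d2)) \<le> c * norm (1 :: real)"
    proof (eventually_elim, intro allI impI)
      fix T d1 d2 :: nat and G :: real
      assume T: "2 * real T * exp (- sqrt (real T)) < c" and *: "0 < G \<and> G \<le> 1 \<and> 1 \<le> d1 \<and> 1 \<le> d2"
      have "G * (2 * real T * exp (- sqrt (real T))) \<le> 2 * real T * exp (- sqrt (real T))"
        using * by (intro mult_left_le_one_le) auto
      then show "norm (e (T, G, d1, d2)) \<le> c * norm (1 :: real)"
        using T * by (simp add: e_def abs_mult mult_ac)
    qed
  qed
  moreover have "regret_bound G T d1 d2 = f (T, G, d1, d2) + e (T, G, d1, d2) * real (max d1 d2)" for T G d1 d2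
    by (simp add: regret_bound_def f_def e_def mult_ac)
  ultimately show ?thesis
    by (intro exI[of _ f] exI[of _ e] conjI allI impI)
qed

theorem theorem3:
  fixes A :: "nat \<Rightarrow> real ^ 'n ^ 'm"
    and x :: "nat \<Rightarrow> real ^ 'm" and y :: "nat \<Rightarrow> real ^ 'n"
    and T :: nat and G \<eta> \<theta> :: real
  assumes "T \<ge> 1"
    and "\<And>t i j. t \<in> {1..T} \<Longrightarrow> A t $ i $ j \<in> {-1..1}"
    and "0 < G" and "G \<le> 1"
    and "\<And>t. t \<in> {1..T} \<Longrightarrow> lipschitz_norm1_on G prob_simplex prob_simplex (bilin (A t))"
    and "\<eta> = sqrt (real T) / G"
    and "\<theta> = exp (- (\<eta> * G))"
    and "\<theta> \<le> min (1 / real CARD('m)) (1 / real CARD('n))"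
    and "omg_rftl_run \<eta> \<theta> T A x y"
  shows "\<bar>(\<Sum>t=1..T. bilin (A t) (x t) (y t))
            - (INF u\<in>prob_simplex. SUP v\<in>prob_simplex. \<Sum>t=1..T. bilin (A t) u v)\<bar>
          \<le> regret_bound G T CARD('m) CARD('n)
    \<and> (\<exists>f e :: nat \<times> real \<times> nat \<times> nat \<Rightarrow> real.
          (\<forall>T G d1 d2. 1 \<le> T \<and> 0 < G \<and> G \<le> 1 \<and> 1 \<le> d1 \<and> 1 \<le> d2 \<longrightarrow>
             regret_bound G T d1 d2 = f (T, G, d1, d2) + e (T, G, d1, d2) * real (max d1 d2))
        \<and> f \<in> O[unif_at_top](\<lambda>(T, G, d1, d2).
               ln (real T) * sqrt (real T) + sqrt (real T) * max (ln (real d1)) (ln (real d2)))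
        \<and> e \<in> o[unif_at_top](\<lambda>_. 1))"
proof (rule conjI[OF _ regret_bound_asymptotics])
  have \<theta>_le: "\<theta> \<le> 1 / real CARD('m)" "\<theta> \<le> 1 / real CARD('n)"
    using assms(8) by auto
  show "\<bar>(\<Sum>t=1..T. bilin (A t) (x t) (y t))
            - (INF u\<in>prob_simplex. SUP v\<in>prob_simplex. \<Sum>t=1..T. bilin (A t) u v)\<bar>
          \<le> regret_bound G T CARD('m) CARD('n)"
    by (rule omg_rftl_regret) (fact assms \<theta>_le)+
qed

end
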